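(* If a domain $\Omega\subset\mathbb R^d$ is a strongly Lipschitz domain, then $\Omega$ is regular in the sense of Gröger.
   Context: Strongly Lipschitz domain: a bounded domain $\Omega\subset\mathbb R^d$ with Lipschitz boundary. An open bounded set $\Omega\subset\mathbb R^d$ has Lipschitz boundary if there is $l\in\mathbb N$ such that $\partial\Omega$ can be covered by open sets $U^1,\dots,U^l$ and for each $j=1,\dots,l$ there exist a Euclidean coordinate system (orthonormal basis) $e^j_1,\dots,e^j_d$ of $\mathbb R^d$, a reference point $y^j\in\mathbb R^{d-1}$, numbers $r^j,h^j>0$ and a Lipschitz continuous function $\eta^j:\mathbb R^{d-1}\to\mathbb R$ such that, writing $x=\sum_{i=1}^dx^j_ie^j_i$ and $x^j_{-,d}=(x^j_1,\dots,x^j_{d-1})$: (i) $U^j=\{x\in\mathbb R^d: |x^j_{-,d}-y^j|_2<r^j\text{ and }|x^j_d-\eta^j(x^j_{-,d})|<h^j\}$; (ii) for all $x\in U^j$, if $x^j_d=\eta^j(x^j_{-,d})$ then $x\in\partial\Omega$; (iii) for all $x\in U^j$, if $0<x^j_d-\eta^j(x^j_{-,d})<h^j$ then $x\in\Omega$; (iv) for all $x\in U^j$, if $0>x^j_d-\eta^j(x^j_{-,d})>-h^j$ then $x\notin\Omega$. Gröger regularity: a set $G\subset\mathbb R^d$ is regular (in the sense of Gröger) if $G$ is bounded and for every $y\in\partial G$ there exist subsets $U,\tilde U\subset\mathbb R^d$ and a Lipschitz continuous bijection $\Phi:U\to\tilde U$ with Lipschitz continuous inverse such that $U$ is an open neighborhood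 of $y$ in $\mathbb R^d$ and $\Phi(U\cap G)$ is one of the sets $E_1=\{x\in\mathbb R^d:|x|<1,\ x_d<0\}$, $E_2=\{x\in\mathbb R^d:|x|<1,\ x_d\le0\}$, $E_3=\{x\in E_2: x_d<0\text{ or }x_1>0\}$. *)

theory Defs
  imports "HOL-Analysis.Analysis"
begin

text \<open>
  The space \<open>\<real>\<^sup>d\<close> is rendered as \<open>real ^ 'n\<close> for an arbitrary finite linearly ordered index type
  \<open>'n\<close> with \<open>d = CARD('n) \<ge> 1\<close>; the order singles out the indices \<open>1\<close> and \<open>d\<close>.
\<close>

definition first_ix :: "'n::{finite,linorder}" where
  "first_ix = Min UNIV"

definition last_ix :: "'n::{finite,linorder}" where
  "last_ix = Max UNIV"

definition lipschitz_cont_on :: "'a::metric_space set \<Rightarrow> ('a \<Rightarrow> 'b::metric_space) \<Rightarrow> bool" where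
  "lipschitz_cont_on S f \<longleftrightarrow> (\<exists>L. L-lipschitz_on S f)"

definition orthonormal_basis :: "('n::finite \<Rightarrow> real ^ 'n) \<Rightarrow> bool" where
  "orthonormal_basis e \<longleftrightarrow>
     (\<forall>i j. e i \<bullet> e j = (if i = j then 1 else 0)) \<and> span (range e) = UNIV"

text \<open>
  The coordinates \<open>x\<^sub>i\<close> with \<open>x = (\<Sum>i. x\<^sub>i e\<^sub>i)\<close> are the inner products \<open>x \<bullet> e i\<close>:
\<close>

lemma orthonormal_basis_coordinates:
  assumes "orthonormal_basis e"
  shows "x = (\<Sum>i\<in>UNIV. c i *\<^sub>R e i) \<longleftrightarrow> (\<forall>i. c i = x \<bullet> e i)"
proof -
  have on: "e i \<bullet> e j = (if i = j then 1 else 0)" for i j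
    using assms by (simp add: orthonormal_basis_def)
  have inner: "(\<Sum>i\<in>UNIV. a i *\<^sub>R e i) \<bullet> e j = a j" for a j
    by (simp add: inner_sum_left on mult_delta_right)
  have "x \<in> span (range e)"
    using assms by (simp add: orthonormal_basis_def)
  then obtain a where a: "x = (\<Sum>i\<in>UNIV. a i *\<^sub>R e i)"
  proof (induction arbitrary: thesis rule: span_induct_alt)
    case base
    show ?case by (rule base[of "\<lambda>_. 0"]) simp
  next
    case (step k b y)
    obtain a j where a: "y = (\<Sum>i\<in>UNIV. a i *\<^sub>R e i)" and j: "b = e j"
      using step by blast
    show ?case
      by (rule step.prems[of "\<lambda>i. (if i = j then k else 0) + a i"])
        (simp add: a j scaleR_left_distrib sum.distrib if_distrib[of "\<lambda>t. t *\<^sub>R _"] cong: if_cong)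
  qed
  show ?thesis
  proof
    assume "x = (\<Sum>i\<in>UNIV. c i *\<^sub>R e i)"
    then show "\<forall>i. c i = x \<bullet> e i" by (simp add: inner)
  next
    assume "\<forall>i. c i = x \<bullet> e i"
    then show "x = (\<Sum>i\<in>UNIV. c i *\<^sub>R e i)" using a by (simp add: inner)
  qed
qed

text \<open>
  Since index types are nonempty, \<open>\<real>\<^sup>d\<^sup>-\<^sup>1\<close> has no Euclidean space type when \<open>d = 1\<close>. It is therefore
  identified with the subspace \<open>\<real>\<^sup>d\<^sup>-\<^sup>1 \<times> {0}\<close> of \<open>\<real>\<^sup>d\<close>; this is an isometry, so norms and Lipschitz
  continuity are the ones of \<open>\<real>\<^sup>d\<^sup>-\<^sup>1\<close>. A function on \<open>\<real>\<^sup>d\<^sup>-\<^sup>1\<close> is a total function of which only the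
  values on this subspace are used.
\<close>

definition hyper :: "(real ^ 'n::{finite,linorder}) set" where
  "hyper = {z. z $ last_ix = 0}"

definition lead_coords ::
    "('n \<Rightarrow> real ^ 'n::{finite,linorder}) \<Rightarrow> real ^ 'n::{finite,linorder} \<Rightarrow> real ^ 'n::{finite,linorder}" where
  "lead_coords e x = (\<chi> i. if i = last_ix then 0 else x \<bullet> e i)"

definition last_coord ::
    "('n \<Rightarrow> real ^ 'n::{finite,linorder}) \<Rightarrow> real ^ 'n::{finite,linorder} \<Rightarrow> real" where
  "last_coord e x = x \<bullet> e last_ix"

definition lipschitz_graph_chart ::
    "(real ^ 'n::{finite,linorder}) set \<Rightarrow> (real ^ 'n::{finite,linorder}) set \<Rightarrow> bool" where
  "lipschitz_graph_chart \<Omega> U \<longleftrightarrow>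
     (\<exists>e y r h \<eta>.
        orthonormal_basis e \<and> y \<in> hyper \<and> r > 0 \<and> h > 0 \<and> lipschitz_cont_on hyper \<eta> \<and>
        U = {x. norm (lead_coords e x - y) < r \<and> \<bar>last_coord e x - \<eta> (lead_coords e x)\<bar> < h} \<and>
        (\<forall>x\<in>U. last_coord e x = \<eta> (lead_coords e x) \<longrightarrow> x \<in> frontier \<Omega>) \<and>
        (\<forall>x\<in>U. 0 < last_coord e x - \<eta> (lead_coords e x) \<and>
                last_coord e x - \<eta> (lead_coords e x) < h \<longrightarrow> x \<in> \<Omega>) \<and>
        (\<forall>x\<in>U. 0 > last_coord e x - \<eta> (lead_coords e x) \<and>
                last_coord e x - \<eta> (lead_coords e x) > - h \<longrightarrow> x \<notin> \<Omega>))"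

definition has_lipschitz_boundary :: "(real ^ 'n::{finite,linorder}) set \<Rightarrow> bool" where
  "has_lipschitz_boundary \<Omega> \<longleftrightarrow>
     (\<exists>(l :: nat) U.
        frontier \<Omega> \<subseteq> (\<Union>j\<in>{1..l}. U j) \<and>
        (\<forall>j\<in>{1..l}. open (U j) \<and> lipschitz_graph_chart \<Omega> (U j)))"

definition is_domain :: "'a::topological_space set \<Rightarrow> bool" where
  "is_domain \<Omega> \<longleftrightarrow> open \<Omega> \<and> connected \<Omega> \<and> \<Omega> \<noteq> {}"

definition strongly_lipschitz_domain :: "(real ^ 'n::{finite,linorder}) set \<Rightarrow> bool" where
  "strongly_lipschitz_domain \<Omega> \<longleftrightarrow>
     is_domain \<Omega> \<and> bounded \<Omega> \<and> has_lipschitz_boundary \<Omega>"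

definition groeger_E1 :: "(real ^ 'n::{finite,linorder}) set" where
  "groeger_E1 = {x. norm x < 1 \<and> x $ last_ix < 0}"

definition groeger_E2 :: "(real ^ 'n::{finite,linorder}) set" where
  "groeger_E2 = {x. norm x < 1 \<and> x $ last_ix \<le> 0}"

definition groeger_E3 :: "(real ^ 'n::{finite,linorder}) set" where
  "groeger_E3 = {x \<in> groeger_E2. x $ last_ix < 0 \<or> x $ first_ix > 0}"

definition groeger_regular :: "(real ^ 'n::{finite,linorder}) set \<Rightarrow> bool" where
  "groeger_regular G \<longleftrightarrow>
     bounded G \<and>
     (\<forall>y\<in>frontier G.
        \<exists>U (U' :: (real ^ 'n::{finite,linorder}) set) \<Phi>.
          bij_betw \<Phi> U U' \<and> lipschitz_cont_on U \<Phi> \<and> lipschitz_cont_on U' (inv_into U \<Phi>) \<and>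
          open U \<and> y \<in> U \<and>
          \<Phi> ` (U \<inter> G) \<in> {groeger_E1, groeger_E2, groeger_E3})"

end

theory Submission imports Defs begin

text \<open>
  A boundary point lies on the graph of \<open>\<eta>\<close> of some chart. In the chart's coordinates the reflected
  shear \<open>(z, t) \<mapsto> (z, \<eta> z - t)\<close> is a bi-Lipschitz involution of \<open>\<real>\<^sup>d\<close> that maps the graph to the
  hyperplane and \<open>\<Omega>\<close> locally to the lower half-space. Translating the boundary point to the origin
  and dilating, the preimage of the unit ball lies inside the chart and meets \<open>\<Omega>\<close> in the preimage
  of \<open>E\<^sub>1\<close>.
\<close>

section \<open>Orthonormal coordinates as an isometry\<close>

definition coords :: "('n \<Rightarrow> real ^ 'n::{finite,linorder}) \<Rightarrow> real ^ 'n::{finite,linorder} \<Rightarrow> real ^ 'n::{finite,linorder}" where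
  "coords e x = (\<chi> i. x \<bullet> e i)"

text \<open>Pairing \<open>x\<close> with its expansion in the basis gives Parseval's identity, so
  the linear map \<open>coords e\<close> preserves norms.\<close>

lemma orthogonal_transformation_coords:
  fixes e :: "'n \<Rightarrow> real ^ 'n::{finite,linorder}"
  assumes "orthonormal_basis e"
  shows "orthogonal_transformation (coords e)"
proof -
  have lin: "linear (coords e)"
    by (rule linearI) (simp_all add: coords_def vec_eq_iff inner_add_left)
  have "norm (coords e x) = norm x" for x
  proof -
    have "x = (\<Sum>i\<in>UNIV. (x \<bullet> e i) *\<^sub>R e i)"
      using orthonormal_basis_coordinates[OF assms, of x "\<lambda>i. x \<bullet> e i"] by simp
    then have "x \<bullet> x = x \<bullet> (\<Sum>i\<in>UNIV. (x \<bullet> e i) *\<^sub>R e i)"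
      by simp
    also have "\<dots> = (\<Sum>i\<in>UNIV. (x \<bullet> e i) * (x \<bullet> e i))"
      unfolding inner_sum_right inner_scaleR_right ..
    also have "\<dots> = coords e x \<bullet> coords e x"
      unfolding inner_vec_def[of "coords e x"] by (simp add: coords_def)
    finally show ?thesis
      by (simp add: norm_eq_sqrt_inner)
  qed
  with lin show ?thesis
    by (simp add: orthogonal_transformation)
qed

lemma lipschitz_on_orthogonal_transformation:
  assumes "orthogonal_transformation (f :: 'a::euclidean_space \<Rightarrow> 'a)"
  shows "1-lipschitz_on S f"
  using assms by (intro lipschitz_onI) (auto simp: orthogonal_transformation_isometry)

section \<open>Projection to the hyperplane and the flip along a graph\<close>

definition hyper_proj :: "real ^ 'n::{finite,linorder} \<Rightarrow> real ^ 'n::{finite,linorder}" where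
  "hyper_proj w = (\<chi> i. if i = last_ix then 0 else w $ i)"

lemma hyper_proj_in_hyper [simp]: "hyper_proj w \<in> hyper"
  by (simp add: hyper_proj_def hyper_def)

lemma lead_coords_eq: "lead_coords e x = hyper_proj (coords e x)"
  by (simp add: lead_coords_def hyper_proj_def coords_def vec_eq_iff)

lemma last_coord_eq: "last_coord e x = coords e x $ last_ix"
  by (simp add: last_coord_def coords_def)

lemma hyper_proj_diff: "hyper_proj (u - v) = hyper_proj u - hyper_proj v"
  by (simp add: hyper_proj_def vec_eq_iff)

lemma norm_hyper_proj_le: "norm (hyper_proj w) \<le> norm w"
  by (rule norm_le_componentwise_cart) (simp add: hyper_proj_def)

text \<open>The sign is reversed because charts put the domain above the graph, whereas
  \<open>groeger_E1\<close> lies below the hyperplane. It also makes the map an involution, so a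
  single Lipschitz estimate serves both directions.\<close>

definition graph_flip :: "(real ^ 'n::{finite,linorder} \<Rightarrow> real) \<Rightarrow> real ^ 'n::{finite,linorder} \<Rightarrow> real ^ 'n::{finite,linorder}" where
  "graph_flip \<eta> w = (\<chi> i. if i = last_ix then \<eta> (hyper_proj w) - w $ last_ix else w $ i)"

lemma hyper_proj_graph_flip [simp]: "hyper_proj (graph_flip \<eta> w) = hyper_proj w"
  by (simp add: hyper_proj_def graph_flip_def vec_eq_iff)

lemma graph_flip_last [simp]: "graph_flip \<eta> w $ last_ix = \<eta> (hyper_proj w) - w $ last_ix"
  by (simp add: graph_flip_def)

lemma graph_flip_graph_flip [simp]: "graph_flip \<eta> (graph_flip \<eta> w) = w"
proof -
  have "graph_flip \<eta> (graph_flip \<eta> w) $ i = w $ i" for i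
  proof (cases "i = last_ix")
    case False
    then show ?thesis
      by (simp add: graph_flip_def)
  qed simp
  then show ?thesis
    by (simp add: vec_eq_iff)
qed

text \<open>The flip adds to its argument a multiple of the last axis vector. Between two points
  this multiple changes by \<open>c\<close>, which is at most \<open>L + 2\<close> times their
  distance; the identity contributes 1 more.\<close>

lemma lipschitz_on_graph_flip:
  fixes \<eta> :: "real ^ 'n::{finite,linorder} \<Rightarrow> real"
  assumes "L-lipschitz_on hyper \<eta>"
  shows "(3 + L)-lipschitz_on S (graph_flip \<eta>)"
proof (rule lipschitz_onI)
  have L: "0 \<le> L"
    using assms by (rule lipschitz_on_nonneg)
  then show "0 \<le> 3 + L"
    by simp
  fix u v :: "real ^ 'n::{finite,linorder}"
  define c where "c = \<eta> (hyper_proj u) - \<eta> (hyper_proj v) - 2 * (u - v) $ last_ix"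
  have "\<bar>\<eta> (hyper_proj u) - \<eta> (hyper_proj v)\<bar> \<le> L * norm (hyper_proj (u - v))"
    using lipschitz_onD[OF assms, of "hyper_proj u" "hyper_proj v"]
    by (simp add: dist_norm hyper_proj_diff)
  also have "\<dots> \<le> L * norm (u - v)"
    by (intro mult_left_mono norm_hyper_proj_le L)
  finally have "\<bar>c\<bar> \<le> L * norm (u - v) + 2 * norm (u - v)"
    using component_le_norm_cart[of "u - v" last_ix] unfolding c_def by linarith
  moreover have "graph_flip \<eta> u - graph_flip \<eta> v = (u - v) + c *\<^sub>R axis last_ix 1"
    by (simp add: vec_eq_iff graph_flip_def axis_def c_def)
  then have "norm (graph_flip \<eta> u - graph_flip \<eta> v) \<le> norm (u - v) + \<bar>c\<bar>"
    using norm_triangle_ineq[of "u - v" "c *\<^sub>R axis last_ix 1"] by simp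
  ultimately show "dist (graph_flip \<eta> u) (graph_flip \<eta> v) \<le> (3 + L) * dist u v"
    by (simp add: dist_norm algebra_simps)
qed

section \<open>Affine maps and composition of Lipschitz maps\<close>

lemma lipschitz_on_affine:
  fixes b :: "'a::real_normed_vector"
  shows "\<bar>a\<bar>-lipschitz_on S (\<lambda>x. a *\<^sub>R x + b)"
  by (rule lipschitz_onI) (simp_all add: dist_norm flip: scaleR_diff_right)

lemma lipschitz_cont_on_compose:
  assumes "lipschitz_cont_on UNIV f" "lipschitz_cont_on UNIV g"
  shows "lipschitz_cont_on S (\<lambda>x. g (f x))"
proof -
  obtain L M where L: "L-lipschitz_on UNIV f" and M: "M-lipschitz_on UNIV g"
    using assms by (auto simp: lipschitz_cont_on_def)
  have "(M * L)-lipschitz_on UNIV (\<lambda>x. g (f x))"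
    by (rule lipschitz_on_compose2[OF L]) (rule lipschitz_on_subset[OF M subset_UNIV])
  then show ?thesis
    unfolding lipschitz_cont_on_def using lipschitz_on_subset by blast
qed

lemma lipschitz_cont_on_imp_continuous_on:
  "lipschitz_cont_on S f \<Longrightarrow> continuous_on S f"
  by (auto simp: lipschitz_cont_on_def intro: lipschitz_on_continuous_on)

section \<open>The chart around a point of the graph\<close>

text \<open>Equal radius and height \<rho> let one dilation fit the preimage of the unit ball into
  the cylinder where \<open>G\<close> is known. By \<open>above\<close>, graph points there lie
  outside \<open>G\<close>, which leads to the model with strict inequality.\<close>

lemma groeger_chart:
  fixes e :: "'n \<Rightarrow> real ^ 'n::{finite,linorder}"
  assumes e: "orthonormal_basis e"
    and eta: "lipschitz_cont_on hyper \<eta>"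
    and y: "last_coord e y = \<eta> (lead_coords e y)"
    and rho: "\<rho> > 0"
    and above: "\<forall>x. norm (lead_coords e x - lead_coords e y) < \<rho> \<longrightarrow>
        \<bar>last_coord e x - \<eta> (lead_coords e x)\<bar> < \<rho> \<longrightarrow>
        (x \<in> G \<longleftrightarrow> \<eta> (lead_coords e x) < last_coord e x)"
  shows "\<exists>U (U' :: (real ^ 'n::{finite,linorder}) set) \<Phi>.
          bij_betw \<Phi> U U' \<and> lipschitz_cont_on U \<Phi> \<and> lipschitz_cont_on U' (inv_into U \<Phi>) \<and>
          open U \<and> y \<in> U \<and> \<Phi> ` (U \<inter> G) = groeger_E1"
proof -
  \<comment> \<open>Subtracting the flipped image of \<open>y\<close> sends \<open>y\<close> to the
    origin. Its last entry is 0 because \<open>y\<close> lies on the graph.\<close>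
  define z where "z = graph_flip \<eta> (coords e y)"
  define \<Phi> where "\<Phi> = (\<lambda>x. (1 / \<rho>) *\<^sub>R graph_flip \<eta> (coords e x) + (- (1 / \<rho>)) *\<^sub>R z)"
  \<comment> \<open>The flip is its own inverse, so it appears here again, between the inverses of
    the outer maps.\<close>
  define \<Psi> where "\<Psi> = (\<lambda>w. inv (coords e) (graph_flip \<eta> (\<rho> *\<^sub>R w + z)))"
  have ot: "orthogonal_transformation (coords e)"
    using e by (rule orthogonal_transformation_coords)
  then have bij: "bij (coords e)"
    by (rule orthogonal_transformation_bij)
  have \<Psi>\<Phi> [simp]: "\<Psi> (\<Phi> x) = x" for x
    using rho bij by (simp add: \<Phi>_def \<Psi>_def scaleR_diff_right bij_is_inj)
  have \<Phi>\<Psi> [simp]: "\<Phi> (\<Psi> w) = w" for w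
    using rho bij by (simp add: \<Phi>_def \<Psi>_def scaleR_add_right bij_is_surj surj_f_inv_f)
  have flip: "lipschitz_cont_on UNIV (graph_flip \<eta>)"
    using eta lipschitz_on_graph_flip unfolding lipschitz_cont_on_def by blast
  have \<Phi>_lip: "lipschitz_cont_on S \<Phi>" for S
  proof -
    have 1: "lipschitz_cont_on UNIV (coords e)"
      using lipschitz_on_orthogonal_transformation[OF ot] unfolding lipschitz_cont_on_def by blast
    have 2: "lipschitz_cont_on UNIV (\<lambda>w. (1 / \<rho>) *\<^sub>R w + (- (1 / \<rho>)) *\<^sub>R z)"
      unfolding lipschitz_cont_on_def using lipschitz_on_affine by blast
    show ?thesis
      unfolding \<Phi>_def
      by (rule lipschitz_cont_on_compose[OF lipschitz_cont_on_compose[OF 1 flip] 2])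
  qed
  have \<Psi>_lip: "lipschitz_cont_on S \<Psi>" for S
  proof -
    have 1: "lipschitz_cont_on UNIV (\<lambda>w. \<rho> *\<^sub>R w + z)"
      unfolding lipschitz_cont_on_def using lipschitz_on_affine by blast
    have 2: "lipschitz_cont_on UNIV (inv (coords e))"
      using lipschitz_on_orthogonal_transformation[OF orthogonal_transformation_inv[OF ot]]
      unfolding lipschitz_cont_on_def by blast
    show ?thesis
      unfolding \<Psi>_def
      by (rule lipschitz_cont_on_compose[OF lipschitz_cont_on_compose[OF 1 flip] 2])
  qed
  \<comment> \<open>As \<Phi> is a bijection of the whole space, the image of this preimage is
    exactly the ball; continuity makes it open.\<close>
  define U where "U = \<Phi> -` ball 0 1"
  have inj: "inj_on \<Phi> U"
    by (metis \<Psi>\<Phi> inj_onI)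
  have "ball 0 1 \<subseteq> \<Phi> ` U"
  proof
    fix w :: "real ^ 'n::{finite,linorder}"
    assume "w \<in> ball 0 1"
    then have "\<Psi> w \<in> U"
      by (simp add: U_def)
    then show "w \<in> \<Phi> ` U"
      using \<Phi>\<Psi>[of w] by (metis imageI)
  qed
  then have img: "\<Phi> ` U = ball 0 1"
    by (auto simp: U_def)
  \<comment> \<open>On the ball the inverse is \<Psi>, from which it inherits the Lipschitz
    bound.\<close>
  have inv_eq: "inv_into U \<Phi> w = \<Psi> w" if "w \<in> ball 0 1" for w
    using that by (intro inv_into_f_eq[OF inj]) (auto simp: U_def)
  have "lipschitz_cont_on (ball 0 1) (inv_into U \<Phi>)"
    using \<Psi>_lip[of "ball 0 1"] unfolding lipschitz_cont_on_def
    by (metis inv_eq lipschitz_on_cong)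
  moreover have "open U"
    unfolding U_def
    by (rule open_vimage[OF open_ball lipschitz_cont_on_imp_continuous_on[OF \<Phi>_lip]])
  moreover have "y \<in> U"
    using rho by (simp add: U_def \<Phi>_def z_def)
  moreover have "\<Phi> ` (U \<inter> G) = groeger_E1"
  proof -
    have z_last: "z $ last_ix = 0"
      using y by (simp add: z_def last_coord_eq lead_coords_eq)
    \<comment> \<open>The flip keeps the hyperplane part and negates the height over the
      graph.\<close>
    have last: "last_coord e x - \<eta> (lead_coords e x) = - (\<rho> * \<Phi> x $ last_ix)" for x
      using rho z_last by (simp add: \<Phi>_def last_coord_eq lead_coords_eq)
    have lead: "lead_coords e x - lead_coords e y = \<rho> *\<^sub>R hyper_proj (\<Phi> x)" for x
    proof -
      have "\<rho> *\<^sub>R \<Phi> x = graph_flip \<eta> (coords e x) - z"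
        using rho by (simp add: \<Phi>_def algebra_simps)
      then have "hyper_proj (\<rho> *\<^sub>R \<Phi> x) = lead_coords e x - lead_coords e y"
        by (simp add: hyper_proj_diff z_def lead_coords_eq)
      moreover have "hyper_proj (\<rho> *\<^sub>R \<Phi> x) = \<rho> *\<^sub>R hyper_proj (\<Phi> x)"
        by (simp add: hyper_proj_def vec_eq_iff)
      ultimately show ?thesis
        by simp
    qed
    \<comment> \<open>Neither the projection nor a single entry exceeds the norm, so every point of
      \<open>U\<close> lies in the cylinder of \<open>above\<close>.\<close>
    have mem: "x \<in> G \<longleftrightarrow> \<Phi> x $ last_ix < 0" if "x \<in> U" for x
    proof -
      have n: "norm (\<Phi> x) < 1"
        using that by (simp add: U_def)
      have "norm (lead_coords e x - lead_coords e y) < \<rho>"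
        using rho le_less_trans[OF norm_hyper_proj_le n] by (simp add: lead)
      moreover have "\<bar>last_coord e x - \<eta> (lead_coords e x)\<bar> < \<rho>"
        using rho le_less_trans[OF component_le_norm_cart n, of last_ix] by (simp add: last abs_mult)
      ultimately have "x \<in> G \<longleftrightarrow> 0 < last_coord e x - \<eta> (lead_coords e x)"
        using above by simp
      then show ?thesis
        using rho by (simp add: last mult_less_0_iff)
    qed
    then have "\<Phi> ` (U \<inter> G) = {w \<in> \<Phi> ` U. w $ last_ix < 0}"
      by blast
    then show ?thesis
      by (simp add: img groeger_E1_def)
  qed
  ultimately show ?thesis
    using \<Phi>_lip inj img unfolding bij_betw_def by blast
qed

section \<open>From the Lipschitz boundary to regularity\<close>

theorem lemmaA3:
  fixes \<Omega> :: "(real ^ 'n::{finite,linorder}) set"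
  assumes "strongly_lipschitz_domain \<Omega>"
  shows "groeger_regular \<Omega>"
  unfolding groeger_regular_def
proof (intro conjI ballI)
  show "bounded \<Omega>"
    using assms by (simp add: strongly_lipschitz_domain_def)
  have "open \<Omega>"
    using assms by (simp add: strongly_lipschitz_domain_def is_domain_def)
  fix x0
  assume x0: "x0 \<in> frontier \<Omega>"
  then have x0_notin: "x0 \<notin> \<Omega>"
    using \<open>open \<Omega>\<close> by (simp add: frontier_def interior_open)
  obtain V where "open V" "x0 \<in> V" "lipschitz_graph_chart \<Omega> V"
    using assms x0 unfolding strongly_lipschitz_domain_def has_lipschitz_boundary_def by blast
  then obtain e y r h \<eta> where e: "orthonormal_basis e"
    and eta: "lipschitz_cont_on hyper \<eta>"
    and V: "V = {x. norm (lead_coords e x - y) < r \<and> \<bar>last_coord e x - \<eta> (lead_coords e x)\<bar> < h}"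
    and on: "\<forall>x\<in>V. last_coord e x = \<eta> (lead_coords e x) \<longrightarrow> x \<in> frontier \<Omega>"
    and up: "\<forall>x\<in>V. 0 < last_coord e x - \<eta> (lead_coords e x) \<and>
                last_coord e x - \<eta> (lead_coords e x) < h \<longrightarrow> x \<in> \<Omega>"
    and down: "\<forall>x\<in>V. 0 > last_coord e x - \<eta> (lead_coords e x) \<and>
                last_coord e x - \<eta> (lead_coords e x) > - h \<longrightarrow> x \<notin> \<Omega>"
    unfolding lipschitz_graph_chart_def by auto
  \<comment> \<open>The three chart conditions merge into one criterion: graph points are frontier
    points, hence outside the open \<Omega>.\<close>
  have mem: "x \<in> \<Omega> \<longleftrightarrow> \<eta> (lead_coords e x) < last_coord e x" if "x \<in> V" for x
  proof (cases "last_coord e x" "\<eta> (lead_coords e x)" rule: linorder_cases)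
    case equal
    then show ?thesis
      using on that \<open>open \<Omega>\<close> by (auto simp: frontier_def interior_open)
  qed (use that up down in \<open>auto simp: V\<close>)
  \<comment> \<open>The chart only places the graph inside the frontier; here the converse is
    needed. Above the graph \<open>x0\<close> would belong to \<Omega>; below it, a neighbourhood of
    \<open>x0\<close> would miss \<Omega> although \<open>x0\<close> is in the closure.\<close>
  have x0_graph: "last_coord e x0 = \<eta> (lead_coords e x0)"
  proof (rule ccontr)
    assume "\<not> ?thesis"
    then have below: "last_coord e x0 < \<eta> (lead_coords e x0)"
      using mem[OF \<open>x0 \<in> V\<close>] x0_notin by simp
    have lead: "continuous_on UNIV (lead_coords e)"
      unfolding lead_coords_def
    proof (rule continuous_on_vec_lambda)
      fix i
      show "continuous_on UNIV (\<lambda>x. if i = last_ix then 0 else x \<bullet> e i)"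
        by (cases "i = last_ix") (auto intro!: continuous_intros)
    qed
    \<comment> \<open>Continuity of \<eta> is known on \<open>hyper\<close>, which contains every
      value of \<open>lead_coords e\<close>.\<close>
    have "continuous_on UNIV (\<lambda>x. \<eta> (lead_coords e x))"
      by (rule continuous_on_compose2[OF lipschitz_cont_on_imp_continuous_on[OF eta] lead])
        (auto simp: lead_coords_eq)
    moreover have "continuous_on UNIV (last_coord e)"
      unfolding last_coord_def by (intro continuous_intros)
    ultimately have "open {x. last_coord e x < \<eta> (lead_coords e x)}"
      by (intro open_Collect_less)
    then have "open (V \<inter> {x. last_coord e x < \<eta> (lead_coords e x)})"
      using \<open>open V\<close> by blast
    moreover have "x0 \<in> V \<inter> {x. last_coord e x < \<eta> (lead_coords e x)}"
      using \<open>x0 \<in> V\<close> below by simp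
    moreover have "x0 \<in> closure \<Omega>"
      using x0 by (simp add: frontier_def)
    ultimately obtain x where "x \<in> \<Omega>" "x \<in> V" "last_coord e x < \<eta> (lead_coords e x)"
      by (auto simp: closure_iff_nhds_not_empty)
    then show False
      using mem by fastforce
  qed
  \<comment> \<open>A cylinder recentred over \<open>x0\<close> stays in \<open>V\<close> if its
    height is at most \<open>h\<close> and its radius at most the distance left to the rim of the
    base.\<close>
  define \<rho> where "\<rho> = min h (r - norm (lead_coords e x0 - y))"
  have "\<rho> > 0"
    using \<open>x0 \<in> V\<close> by (auto simp: V \<rho>_def)
  have near: "\<forall>x. norm (lead_coords e x - lead_coords e x0) < \<rho> \<longrightarrow>
      \<bar>last_coord e x - \<eta> (lead_coords e x)\<bar> < \<rho> \<longrightarrow>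
      (x \<in> \<Omega> \<longleftrightarrow> \<eta> (lead_coords e x) < last_coord e x)"
  proof (intro allI impI)
    fix x
    assume "norm (lead_coords e x - lead_coords e x0) < \<rho>"
      and "\<bar>last_coord e x - \<eta> (lead_coords e x)\<bar> < \<rho>"
    then have "x \<in> V"
      using norm_triangle_ineq[of "lead_coords e x - lead_coords e x0" "lead_coords e x0 - y"]
      by (simp add: V \<rho>_def)
    then show "x \<in> \<Omega> \<longleftrightarrow> \<eta> (lead_coords e x) < last_coord e x"
      by (rule mem)
  qed
  show "\<exists>U (U' :: (real ^ 'n::{finite,linorder}) set) \<Phi>.
          bij_betw \<Phi> U U' \<and> lipschitz_cont_on U \<Phi> \<and> lipschitz_cont_on U' (inv_into U \<Phi>) \<and>
          open U \<and> x0 \<in> U \<and> \<Phi> ` (U \<inter> \<Omega>) \<in> {groeger_E1, groeger_E2, groeger_E3}"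
    using groeger_chart[OF e eta x0_graph \<open>\<rho> > 0\<close> near] by (elim ex_forward) simp
qed

end
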